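(* Let $G=(V,E)$ be a simple connected graph with $n=|V|$, and let $\{V_1,V_2,V_3,V_4\}$ be a feasible tetrapartition of $V$ with $|V_1|\le|V_2|\le|V_3|\le|V_4|$ and $|V_4|>\frac25 n$, to which no Merge and no Pull operation is applicable, and such that $|V_2|+|V_3|\ge|V_4|$, $|V_4|<\frac12 n$, $|V_1|\le|V_2|<\frac16|V_4|<\frac1{12}n$, and $|V_3|>\frac13 n$. Suppose we are in Case 1: neither $V_1$ nor $V_2$ is adjacent to $V_3$, and both $V_1$ and $V_2$ are adjacent to $V_4$ only at a single vertex $u\in V_4$ (i.e. every edge between $V_1\cup V_2$ and $V_3\cup V_4$ has $u$ as its endpoint in $V_3\cup V_4$). Let $V'_4$ be the union of the vertex sets of all connected components of $G[V_4\setminus\{u\}]$ that are adjacent to $V_3$. If $|V'_4|\le|V_1|+|V_2|+\frac{11}{24}|V_4|$, then $|V_4|\le\frac{24}{13}\,\mathrm{OPT}$.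
   Context: A feasible tetrapartition of $V$ is a partition into four non-empty parts each inducing a connected subgraph of $G$; $\mathrm{OPT}$ is the minimum, over all feasible tetrapartitions, of the largest part size. Two disjoint vertex sets are adjacent if some edge joins them. For a sorted feasible tetrapartition with $|V_4|>\frac25 n$: a Merge operation is applicable if there are distinct $i,j\in\{1,2,3\}$ with $V_i,V_j$ adjacent and $|V_i|+|V_j|<|V_4|$; a Pull operation is applicable if no Merge is applicable and there exist $(i,j)\in\{(1,3),(1,4),(2,3),(2,4),(3,4)\}$ and a non-empty proper subset $U\subset V_j$ with $G[U]$ and $G[V_j\setminus U]$ connected, $U$ adjacent to $V_i$, and $|V_i|+|U|<|V_j|$. *)

theory Defs
  imports Complex_Main "HOL-Library.Disjoint_Sets" "Graph_Theory.Graph_Theory"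
begin

text \<open>
  A finite simple graph is a digraph in the locale \<open>graph\<close> of \<open>Graph_Theory\<close>: finite, symmetric,
  and without loops or parallel arcs, so that an edge is a pair of opposite arcs.
  \<open>G \<restriction> S\<close> is the subgraph induced by \<open>S\<close>. The null graph is not \<open>connected\<close>.
\<close>

definition adjacent_sets :: "('a, 'b) pre_digraph \<Rightarrow> 'a set \<Rightarrow> 'a set \<Rightarrow> bool" where
  "adjacent_sets G A B \<longleftrightarrow> (\<exists>x\<in>A. \<exists>y\<in>B. x \<rightarrow>\<^bsub>G\<^esub> y)"

text \<open>Non-emptiness of the parts is included in \<open>partition_on\<close>.\<close>

definition feasible_tetrapartition :: "('a, 'b) pre_digraph \<Rightarrow> 'a set set \<Rightarrow> bool" where
  "feasible_tetrapartition G P \<longleftrightarrow>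
     partition_on (verts G) P \<and> card P = 4 \<and> (\<forall>A\<in>P. connected (G \<restriction> A))"

text \<open>Only meaningful if \<open>G\<close> is finite and has a feasible tetrapartition.\<close>

definition OPT :: "('a, 'b) pre_digraph \<Rightarrow> nat" where
  "OPT G = Min {Max (card ` P) |P. feasible_tetrapartition G P}"

text \<open>
  A sorted tetrapartition is given as a family \<open>V\<close> with parts \<open>V 1\<close>, \<open>V 2\<close>, \<open>V 3\<close>, \<open>V 4\<close>.
  Since a feasible tetrapartition has cardinality 4, these parts are distinct; the values of \<open>V\<close>
  at other indices are irrelevant.
\<close>

definition sorted_feasible_tetrapartition ::
    "('a, 'b) pre_digraph \<Rightarrow> (nat \<Rightarrow> 'a set) \<Rightarrow> bool" where
  "sorted_feasible_tetrapartition G V \<longleftrightarrow>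
     feasible_tetrapartition G {V 1, V 2, V 3, V 4} \<and>
     card (V 1) \<le> card (V 2) \<and> card (V 2) \<le> card (V 3) \<and> card (V 3) \<le> card (V 4)"

definition merge_applicable :: "('a, 'b) pre_digraph \<Rightarrow> (nat \<Rightarrow> 'a set) \<Rightarrow> bool" where
  "merge_applicable G V \<longleftrightarrow>
     (\<exists>i\<in>{1, 2, 3}. \<exists>j\<in>{1, 2, 3}. i \<noteq> j \<and> adjacent_sets G (V i) (V j) \<and>
        card (V i) + card (V j) < card (V 4))"

definition pull_applicable :: "('a, 'b) pre_digraph \<Rightarrow> (nat \<Rightarrow> 'a set) \<Rightarrow> bool" where
  "pull_applicable G V \<longleftrightarrow>
     \<not> merge_applicable G V \<and>
     (\<exists>(i, j)\<in>{(1, 3), (1, 4), (2, 3), (2, 4), (3, 4)}. \<exists>U. U \<noteq> {} \<and> U \<subset> V j \<and>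
        connected (G \<restriction> U) \<and> connected (G \<restriction> (V j - U)) \<and>
        adjacent_sets G U (V i) \<and> card (V i) + card U < card (V j))"

text \<open>
  In a symmetric digraph the strongly connected components are the connected components;
  \<open>sccs_verts\<close> is the set of their vertex sets.
\<close>

definition components_adjacent_to ::
    "('a, 'b) pre_digraph \<Rightarrow> 'a set \<Rightarrow> 'a set \<Rightarrow> 'a set" where
  "components_adjacent_to G S B =
     \<Union> {C \<in> pre_digraph.sccs_verts (G \<restriction> S). adjacent_sets G C B}"

end

theory Submission
  imports Defs
begin

text \<open>
  Deleting \<open>u\<close> leaves \<open>V 1\<close>, \<open>V 2\<close>, the components of \<open>V 4 - {u}\<close> and \<open>V 3\<close> as connected pieces,
  with edges only between \<open>V 3\<close> and the components forming \<open>V4'\<close>. As \<open>V 1\<close> is adjacent to \<open>u\<close>,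
  a component of \<open>V 4 - {u}\<close> larger than \<open>V 1\<close> would allow a Pull of its complement in \<open>V 4\<close>.
  So, in any feasible tetrapartition, each of the three parts avoiding \<open>u\<close> lies in
  \<open>V 3 \<union> V4'\<close> or has at most \<open>card (V 2)\<close> elements. If all three lie in \<open>V 3 \<union> V4'\<close>, the part
  of \<open>u\<close> contains \<open>V 1 \<union> V 2 \<union> (V 4 - V4')\<close>; otherwise the three parts other than a small one
  cover more than \<open>11 / 6 * card (V 4)\<close> vertices, so one of them is large.
\<close>

section \<open>Connectivity through arc-closed vertex sets\<close>

lemma dominates_induce_subgraph:
  "x \<rightarrow>\<^bsub>G \<restriction> S\<^esub> y \<longleftrightarrow> x \<rightarrow>\<^bsub>G\<^esub> y \<and> x \<in> S \<and> y \<in> S"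
  by (auto simp: arcs_ends_conv induce_subgraph_def)

lemma (in wf_digraph) reachable_closed:
  assumes "x \<rightarrow>\<^sup>* y" and "x \<in> X" and "\<And>a b. a \<in> X \<Longrightarrow> a \<rightarrow>\<^bsub>G\<^esub> b \<Longrightarrow> b \<in> X"
  shows "y \<in> X"
  using assms(1) by (induction rule: reachable_induct) (auto intro: assms)

text \<open>The set reachable from a vertex is closed under arcs, and a closed set contains whatever
  is reachable from its points. With this criterion most later arguments need only sets and single
  arcs instead of walks.\<close>

lemma (in sym_digraph) connected_iff_closed:
  "connected G \<longleftrightarrow> verts G \<noteq> {} \<and>
     (\<forall>X \<subseteq> verts G. X \<noteq> {} \<and> (\<forall>x\<in>X. \<forall>y. x \<rightarrow>\<^bsub>G\<^esub> y \<longrightarrow> y \<in> X) \<longrightarrow> X = verts G)"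
proof -
  have "connected G \<longleftrightarrow> verts G \<noteq> {} \<and> (\<forall>x \<in> verts G. \<forall>y \<in> verts G. x \<rightarrow>\<^sup>* y)"
    unfolding connected_def strongly_connected_def
    by (simp add: reachable_mk_symmetric_eq[OF sym_arcs])
  also have "\<dots> \<longleftrightarrow> verts G \<noteq> {} \<and>
     (\<forall>X \<subseteq> verts G. X \<noteq> {} \<and> (\<forall>x\<in>X. \<forall>y. x \<rightarrow>\<^bsub>G\<^esub> y \<longrightarrow> y \<in> X) \<longrightarrow> X = verts G)"
  proof (intro conj_cong refl iffI allI impI ballI)
    fix X assume r: "\<forall>x \<in> verts G. \<forall>y \<in> verts G. x \<rightarrow>\<^sup>* y" and X: "X \<subseteq> verts G"
      and cl: "X \<noteq> {} \<and> (\<forall>x\<in>X. \<forall>y. x \<rightarrow>\<^bsub>G\<^esub> y \<longrightarrow> y \<in> X)"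
    from cl obtain x where "x \<in> X" by auto
    then have "y \<in> X" if "y \<in> verts G" for y
      using r X cl that reachable_closed[of x y X] by blast
    then show "X = verts G" using X by blast
  next
    fix x y assume H: "\<forall>X \<subseteq> verts G. X \<noteq> {} \<and> (\<forall>x\<in>X. \<forall>y. x \<rightarrow>\<^bsub>G\<^esub> y \<longrightarrow> y \<in> X) \<longrightarrow> X = verts G"
      and "x \<in> verts G" "y \<in> verts G"
    have "{z. x \<rightarrow>\<^sup>* z} = verts G"
      using \<open>x \<in> verts G\<close>
      by (intro H[rule_format]) (auto intro: reachable_adj_trans dest: reachable_in_verts)
    then show "x \<rightarrow>\<^sup>* y" using \<open>y \<in> verts G\<close> by blast
  qed
  finally show ?thesis .
qed

section \<open>Connected sets and components in induced subgraphs\<close>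

context graph
begin

lemma sym_digraph_induce: "S \<subseteq> verts G \<Longrightarrow> sym_digraph (G \<restriction> S)"
  by unfold_locales
    (auto simp: induce_subgraph_def symmetric_def sym_def dominates_induce_subgraph[unfolded induce_subgraph_def]
      intro: graph_symmetric)

lemma connected_induce_iff:
  assumes "S \<subseteq> verts G"
  shows "connected (G \<restriction> S) \<longleftrightarrow> S \<noteq> {} \<and>
    (\<forall>X \<subseteq> S. X \<noteq> {} \<and> (\<forall>x\<in>X. \<forall>y\<in>S. x \<rightarrow>\<^bsub>G\<^esub> y \<longrightarrow> y \<in> X) \<longrightarrow> X = S)"
proof -
  interpret S: sym_digraph "G \<restriction> S" using assms by (rule sym_digraph_induce)
  show ?thesis
    unfolding S.connected_iff_closed by (auto simp: dominates_induce_subgraph)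
qed

text \<open>Apply the closure criterion to \<open>S \<inter> X\<close>. The set \<open>X\<close> may
  extend beyond \<open>S\<close>, so it can serve as a trap: a connected set that meets
  \<open>X\<close> and has no arc leaving \<open>X\<close> stays inside.\<close>

lemma connected_induce_subset:
  assumes "S \<subseteq> verts G" "connected (G \<restriction> S)" "a \<in> S" "a \<in> X"
    and "\<And>x y. x \<in> X \<Longrightarrow> x \<in> S \<Longrightarrow> y \<in> S \<Longrightarrow> x \<rightarrow>\<^bsub>G\<^esub> y \<Longrightarrow> y \<in> X"
  shows "S \<subseteq> X"
proof -
  have "S \<inter> X = S"
    using assms by (intro assms(2)[unfolded connected_induce_iff[OF assms(1)], THEN conjunct2, rule_format]) auto
  then show ?thesis by blast
qed

lemma sccs_verts_induce_closed:
  assumes "S \<subseteq> verts G" "C \<in> pre_digraph.sccs_verts (G \<restriction> S)"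
    and "x \<in> C" "y \<in> S" "x \<rightarrow>\<^bsub>G\<^esub> y"
  shows "y \<in> C"
proof -
  interpret S: sym_digraph "G \<restriction> S" using assms(1) by (rule sym_digraph_induce)
  have "x \<in> S" using S.sccs_verts_subsets[OF assms(2)] assms(3) by auto
  then have "x \<rightarrow>\<^sup>*\<^bsub>G \<restriction> S\<^esub> y"
    using assms by (intro S.reachable_adjI) (simp add: dominates_induce_subgraph)
  then show ?thesis
    using assms S.symmetric_reachable' unfolding S.in_sccs_verts_conv_reachable by blast
qed

lemma sccs_verts_induce_connected:
  assumes "S \<subseteq> verts G" "C \<in> pre_digraph.sccs_verts (G \<restriction> S)"
  shows "C \<subseteq> S" "connected (G \<restriction> C)"
proof -
  interpret S: sym_digraph "G \<restriction> S" using assms(1) by (rule sym_digraph_induce)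
  show CS: "C \<subseteq> S" using S.sccs_verts_subsets[OF assms(2)] by simp
  have "C \<noteq> {}" and r: "\<And>x y. x \<in> C \<Longrightarrow> y \<in> C \<Longrightarrow> x \<rightarrow>\<^sup>*\<^bsub>G \<restriction> S\<^esub> y"
    using assms(2) unfolding S.in_sccs_verts_conv_reachable by auto
  moreover have "X = C" if X: "X \<subseteq> C" "X \<noteq> {}" "\<forall>x\<in>X. \<forall>y\<in>C. x \<rightarrow>\<^bsub>G\<^esub> y \<longrightarrow> y \<in> X" for X
  proof -
    obtain x where "x \<in> X" using X by auto
    have "y \<in> X" if "y \<in> C" for y
    \<comment> \<open>A walk in \<open>G \<restriction> S\<close> starting in \<open>X\<close>
      cannot leave the component \<open>C\<close>, and inside \<open>C\<close> it cannot leave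
      \<open>X\<close>.\<close>
    proof (rule S.reachable_closed)
      show "x \<rightarrow>\<^sup>*\<^bsub>G \<restriction> S\<^esub> y" using r X \<open>x \<in> X\<close> that by auto
      show "b \<in> X" if "a \<in> X" "a \<rightarrow>\<^bsub>G \<restriction> S\<^esub> b" for a b
        using that X sccs_verts_induce_closed[OF assms, of a b]
        by (auto simp: dominates_induce_subgraph)
    qed fact
    then show ?thesis using X by blast
  qed
  ultimately show "connected (G \<restriction> C)"
    using connected_induce_iff[of C] CS assms(1) by blast
qed

text \<open>Within \<open>S\<close>, a component of \<open>S - {u}\<close> has arcs only to itself
  and to \<open>u\<close>, so removing it leaves everything else attached through \<open>u\<close>.
  This makes the complement of a component a legal set to pull.\<close>

lemma connected_induce_diff_component:
  assumes S: "S \<subseteq> verts G" "connected (G \<restriction> S)" "u \<in> S"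
    and C: "C \<in> pre_digraph.sccs_verts (G \<restriction> (S - {u}))"
  shows "connected (G \<restriction> (S - C))"
proof -
  have Su: "S - {u} \<subseteq> verts G" using S by auto
  note CS = sccs_verts_induce_connected(1)[OF Su C]
  note cl = sccs_verts_induce_closed[OF Su C]
  have empty: "X = {}"
    if "X \<subseteq> S - C" "u \<notin> X" and Xcl: "\<And>x y. x \<in> X \<Longrightarrow> y \<in> S - C \<Longrightarrow> x \<rightarrow>\<^bsub>G\<^esub> y \<Longrightarrow> y \<in> X" for X
  proof (rule ccontr)
    assume "X \<noteq> {}"
    then obtain a where "a \<in> X" by auto
    \<comment> \<open>Closedness in \<open>S - C\<close> extends to \<open>S\<close>: an arc from
      \<open>x\<close> into \<open>C\<close> would put \<open>x\<close>, which differs from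
      \<open>u\<close>, into \<open>C\<close> as well.\<close>
    have "y \<in> X" if "x \<in> X" "y \<in> S" "x \<rightarrow>\<^bsub>G\<^esub> y" for x y
      using that Xcl[of x y] cl[of y x] \<open>X \<subseteq> S - C\<close> \<open>u \<notin> X\<close> by (auto dest: graph_symmetric)
    then have "S \<subseteq> X"
      using \<open>a \<in> X\<close> \<open>X \<subseteq> S - C\<close> by (intro connected_induce_subset[OF S(1,2), of a]) auto
    then show False using S \<open>u \<notin> X\<close> by auto
  qed
  have "X = S - C" if X: "X \<subseteq> S - C" "X \<noteq> {}" "\<forall>x\<in>X. \<forall>y\<in>S - C. x \<rightarrow>\<^bsub>G\<^esub> y \<longrightarrow> y \<in> X" for X
  proof (cases "u \<in> X")
    case True
    \<comment> \<open>By symmetry the complement of a closed set is closed too, and this one misses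
      \<open>u\<close>.\<close>
    have "S - C - X = {}"
      using True X by (intro empty) (auto dest: graph_symmetric)
    then show ?thesis using X by auto
  qed (use empty[of X] X in blast)
  moreover have "u \<in> S - C" using S CS by auto
  ultimately show ?thesis
    using connected_induce_iff[of "S - C"] S by blast
qed

lemma sccs_verts_induce_cover:
  assumes "S \<subseteq> verts G" "x \<in> S"
  obtains C where "C \<in> pre_digraph.sccs_verts (G \<restriction> S)" "x \<in> C"
proof -
  interpret S: sym_digraph "G \<restriction> S" using assms(1) by (rule sym_digraph_induce)
  show thesis
    using that[OF S.scc_of_in_sccs_verts[of x]] assms by (simp add: S.scc_of_def)
qed

text \<open>The given partition \<open>Q\<close> makes the set under \<open>Min\<close> non-empty,
  and it is finite because all partitions lie in \<open>Pow (Pow (verts G))\<close>; hence the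
  minimum is attained.\<close>

lemma OPT_attained:
  assumes "feasible_tetrapartition G Q"
  obtains P where "feasible_tetrapartition G P" "\<And>A. A \<in> P \<Longrightarrow> card A \<le> OPT G"
proof -
  let ?F = "{Max (card ` P) |P. feasible_tetrapartition G P}"
  have "{P. feasible_tetrapartition G P} \<subseteq> Pow (Pow (verts G))"
    by (auto simp: feasible_tetrapartition_def partition_on_def)
  then have "finite {P. feasible_tetrapartition G P}"
    by (rule finite_subset) simp
  then have "OPT G \<in> ?F"
    unfolding OPT_def using assms by (intro Min_in) (auto simp: Setcompr_eq_image)
  then obtain P where P: "feasible_tetrapartition G P" "OPT G = Max (card ` P)" by auto
  have "finite P" using P(1) by (auto simp: feasible_tetrapartition_def intro: card_ge_0_finite)
  then show thesis using that P by auto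
qed

end

theorem theorem3:
  fixes G :: "('a, 'b) pre_digraph" and V :: "nat \<Rightarrow> 'a set" and u :: 'a and n :: nat
    and V4' :: "'a set"
  assumes "graph G" and "Digraph_Component.connected G" and "n = card (verts G)"
    and "sorted_feasible_tetrapartition G V"
    and "card (V 4) > 2 / 5 * real n"
    and "\<not> merge_applicable G V" and "\<not> pull_applicable G V"
    and "card (V 2) + card (V 3) \<ge> card (V 4)"
    and "card (V 4) < 1 / 2 * real n"
    and "card (V 1) \<le> card (V 2)"
    and "card (V 2) < 1 / 6 * real (card (V 4))"
    and "1 / 6 * real (card (V 4)) < 1 / 12 * real n"
    and "card (V 3) > 1 / 3 * real n"
    and "\<not> adjacent_sets G (V 1) (V 3)" and "\<not> adjacent_sets G (V 2) (V 3)"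
    and "u \<in> V 4"
    and "\<forall>x \<in> V 1 \<union> V 2. \<forall>y \<in> V 3 \<union> V 4. x \<rightarrow>\<^bsub>G\<^esub> y \<longrightarrow> y = u"
    and "V4' = components_adjacent_to G (V 4 - {u}) (V 3)"
    and "card V4' \<le> card (V 1) + card (V 2) + 11 / 24 * real (card (V 4))"
  shows "card (V 4) \<le> 24 / 13 * real (OPT G)"
proof -

  \<comment> \<open>Adjacencies and component sizes around \<open>u\<close>\<close>
  interpret graph G by fact
  define W where "W = V 3 \<union> V4'"
  have part: "partition_on (verts G) {V 1, V 2, V 3, V 4}" and "card {V 1, V 2, V 3, V 4} = 4"
    and conn4: "connected (G \<restriction> V 4)" and feas: "feasible_tetrapartition G {V 1, V 2, V 3, V 4}"
    using assms(4) by (auto simp: sorted_feasible_tetrapartition_def feasible_tetrapartition_def)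
  then have dist: "V 1 \<noteq> V 2" "V 1 \<noteq> V 3" "V 1 \<noteq> V 4" "V 2 \<noteq> V 3" "V 2 \<noteq> V 4" "V 3 \<noteq> V 4"
    by (auto simp: card_insert_if split: if_splits)
  have cover: "verts G = V 1 \<union> V 2 \<union> V 3 \<union> V 4"
    using partition_onD1[OF part] by auto
  have disj: "V 1 \<inter> V 4 = {}" "V 2 \<inter> V 4 = {}" "V 3 \<inter> V 4 = {}"
    using partition_onD2[OF part] dist by (auto simp: disjoint_def)
  have nonempty: "V 1 \<noteq> {}" using partition_onD3[OF part] by auto
  have fin: "finite A" if "A \<subseteq> verts G" for A
    using that by (rule finite_subset) simp
  have n: "n = card (V 1) + card (V 2) + card (V 3) + card (V 4)"
  proof -
    have "card (verts G) = (\<Sum>A \<in> {V 1, V 2, V 3, V 4}. card A)"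
      using part cover by (intro product_partition) (auto intro: fin)
    then show ?thesis using assms(3) dist by simp
  qed
  have S4: "V 4 - {u} \<subseteq> verts G" and V4: "V 4 \<subseteq> verts G" using cover by auto
  note sccs_sub = sccs_verts_induce_connected(1)[OF S4]

  \<comment> \<open>Both sizes are below \<open>card (V 4) / 6\<close>, so an arc would make a Merge
    applicable.\<close>
  have not_adj12: "\<not> x \<rightarrow>\<^bsub>G\<^esub> y" if "x \<in> V 1" "y \<in> V 2" for x y
  proof
    assume "x \<rightarrow>\<^bsub>G\<^esub> y"
    then have "adjacent_sets G (V 1) (V 2)" using that by (auto simp: adjacent_sets_def)
    moreover have "card (V 1) + card (V 2) < card (V 4)" using assms(10,11) by linarith
    ultimately show False using assms(6) unfolding merge_applicable_def by force
  qed
  have nb1: "y \<in> V 1 \<or> y = u" if "x \<in> V 1" "x \<rightarrow>\<^bsub>G\<^esub> y" for x y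
    using that not_adj12[of x y] assms(17) adj_in_verts[OF that(2)] cover by blast
  have nb2: "y \<in> V 2 \<or> y = u" if "x \<in> V 2" "x \<rightarrow>\<^bsub>G\<^esub> y" for x y
    using that not_adj12[of y x] assms(17) adj_in_verts[OF that(2)] cover graph_symmetric by blast
  \<comment> \<open>Arcs leaving \<open>V 1\<close> can only end in \<open>u\<close>; without one,
    \<open>V 1\<close> would be closed in the connected graph \<open>G\<close>. This arc supplies
    the adjacency for the Pull below.\<close>
  have "\<exists>x \<in> V 1. x \<rightarrow>\<^bsub>G\<^esub> u"
  proof (rule ccontr)
    assume "\<not> (\<exists>x \<in> V 1. x \<rightarrow>\<^bsub>G\<^esub> u)"
    then have "V 1 = verts G"
      using nb1 nonempty cover
      by (intro assms(2)[unfolded connected_iff_closed, THEN conjunct2, rule_format]) blast+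
    then show False using disj \<open>u \<in> V 4\<close> V4 by auto
  qed
  then obtain w where w: "w \<in> V 1" "u \<rightarrow>\<^bsub>G\<^esub> w" using graph_symmetric by blast

  \<comment> \<open>The set to pull is \<open>V 4 - C\<close>, not \<open>C\<close>: it contains
    \<open>u\<close> and hence touches \<open>V 1\<close>. Its size condition says exactly
    \<open>card (V 1) < card C\<close>.\<close>
  have component_small: "card C \<le> card (V 1)"
    if C: "C \<in> pre_digraph.sccs_verts (G \<restriction> (V 4 - {u}))" for C
  proof (rule ccontr)
    assume "\<not> card C \<le> card (V 1)"
    have CS: "C \<subseteq> V 4 - {u}" and "connected (G \<restriction> C)"
      using sccs_verts_induce_connected[OF S4 C] by auto
    moreover have "connected (G \<restriction> (V 4 - C))"
      using connected_induce_diff_component[OF V4 conn4 \<open>u \<in> V 4\<close> C] .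
    moreover have "V 4 - (V 4 - C) = C" using CS by auto
    moreover have "C \<noteq> {}" using \<open>\<not> card C \<le> card (V 1)\<close> by auto
    moreover have "card (V 1) + card (V 4 - C) < card (V 4)"
    proof -
      have "finite C" "C \<subseteq> V 4" using CS V4 by (auto intro: fin)
      then have "card (V 4 - C) = card (V 4) - card C" by (rule card_Diff_subset)
      moreover have "card C \<le> card (V 4)" using \<open>C \<subseteq> V 4\<close> V4 fin by (intro card_mono) auto
      ultimately show ?thesis using \<open>\<not> card C \<le> card (V 1)\<close> by linarith
    qed
    moreover have "adjacent_sets G (V 4 - C) (V 1)"
      using w \<open>u \<in> V 4\<close> CS by (auto simp: adjacent_sets_def)
    ultimately have "\<exists>U. U \<noteq> {} \<and> U \<subset> V 4 \<and> connected (G \<restriction> U) \<and> connected (G \<restriction> (V 4 - U)) \<and>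
        adjacent_sets G U (V 1) \<and> card (V 1) + card U < card (V 4)"
      using \<open>u \<in> V 4\<close> by (intro exI[of _ "V 4 - C"]) auto
    then show False using assms(6,7) unfolding pull_applicable_def by auto
  qed

  have part_avoiding_u: "A \<subseteq> W \<or> card A \<le> card (V 2)"
    if A: "A \<subseteq> verts G" "connected (G \<restriction> A)" "u \<notin> A" for A
  proof (cases "A \<subseteq> W")
    case False
    then obtain a where a: "a \<in> A" "a \<notin> W" by auto
    \<comment> \<open>A set that can be left only through \<open>u\<close> traps the connected set
      \<open>A\<close>, which avoids \<open>u\<close>. It is used with \<open>V 1\<close>,
      \<open>V 2\<close> and a component of \<open>V 4 - {u}\<close>.\<close>
    have bound: "card A \<le> card B"
      if "a \<in> B" "B \<subseteq> verts G" "\<And>x y. x \<in> B \<Longrightarrow> x \<rightarrow>\<^bsub>G\<^esub> y \<Longrightarrow> y \<in> B \<or> y = u" for B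
    proof (rule card_mono)
      show "A \<subseteq> B" using that a A by (intro connected_induce_subset[OF A(1,2)]) blast+
    qed (use that fin in auto)
    consider "a \<in> V 1" | "a \<in> V 2" | "a \<in> V 4 - {u}"
      using a A cover by (auto simp: W_def)
    then show ?thesis
    proof cases
      case 1
      then show ?thesis using bound[of "V 1"] nb1 cover assms(10) by force
    next
      case 2
      then show ?thesis using bound[of "V 2"] nb2 cover by blast
    next
      case 3
      obtain C where C: "C \<in> pre_digraph.sccs_verts (G \<restriction> (V 4 - {u}))" "a \<in> C"
        using sccs_verts_induce_cover[OF S4 3] .
      have "\<not> adjacent_sets G C (V 3)"
        using a C by (auto simp: W_def assms(18) components_adjacent_to_def)
      \<comment> \<open>Arcs to \<open>V 3\<close> are excluded since \<open>C\<close> is not part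
        of \<open>V4'\<close>; arcs to \<open>V 1\<close> or \<open>V 2\<close> are excluded since
        those two meet the outside only at \<open>u\<close>.\<close>
      then have "y \<in> C \<or> y = u" if "x \<in> C" "x \<rightarrow>\<^bsub>G\<^esub> y" for x y
        using that sccs_verts_induce_closed[OF S4 C(1) that(1) _ that(2)] sccs_sub[OF C(1)]
          nb1[of y x] nb2[of y x] graph_symmetric[OF that(2)] adj_in_verts[OF that(2)] disj cover
        unfolding adjacent_sets_def by blast
      then have "card A \<le> card C"
        using C sccs_sub[OF C(1)] S4 by (intro bound) auto
      then show ?thesis using component_small[OF C(1)] assms(10) by linarith
    qed
  qed auto

  \<comment> \<open>Counting in an optimal tetrapartition\<close>
  obtain P where P: "feasible_tetrapartition G P" and opt: "\<And>A. A \<in> P \<Longrightarrow> card A \<le> OPT G"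
    using OPT_attained[OF feas] by blast
  have partP: "partition_on (verts G) P" and "card P = 4"
    using P by (auto simp: feasible_tetrapartition_def)
  obtain X where X: "X \<in> P" "u \<in> X"
    using partition_onD1[OF partP] \<open>u \<in> V 4\<close> V4 by blast
  have "card (P - {X}) = 3" using X \<open>card P = 4\<close> by simp
  then obtain A B C where ABC: "P - {X} = {A, B, C}" "A \<noteq> B" "B \<noteq> C" "A \<noteq> C"
    by (auto simp: card_3_iff)
  have P_eq: "P = {X, A, B, C}" using ABC(1) X(1) by blast
  have "X \<notin> {A, B, C}" using ABC(1) by blast
  have finP: "finite Y" if "Y \<in> P" for Y
    using that partition_onD1[OF partP] by (intro fin) auto
  have sum: "n = card X + card A + card B + card C"
    using product_partition[OF partP finP] assms(3) ABC(2-4) \<open>X \<notin> {A, B, C}\<close>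
    unfolding P_eq by simp
  have small: "Y \<subseteq> W \<or> card Y \<le> card (V 2)" if "Y \<in> {A, B, C}" for Y
  proof (rule part_avoiding_u)
    have Y: "Y \<in> P" "Y \<noteq> X" using that ABC(1) by blast+
    then show "Y \<subseteq> verts G" "connected (G \<restriction> Y)"
      using P partition_onD1[OF partP] by (auto simp: feasible_tetrapartition_def)
    show "u \<notin> Y" using partition_onD2[OF partP] X Y by (auto simp: disjoint_def)
  qed
  have opts: "card X \<le> OPT G" "card A \<le> OPT G" "card B \<le> OPT G" "card C \<le> OPT G"
    using opt by (simp_all add: P_eq)
  show ?thesis
  proof (cases "A \<subseteq> W \<and> B \<subseteq> W \<and> C \<subseteq> W")
    case True
    have "V4' \<subseteq> V 4"
      using sccs_sub by (auto simp: assms(18) components_adjacent_to_def)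
    then have fins: "finite X" "finite W"
      using X partition_onD1[OF partP] cover V4 by (auto simp: W_def intro!: fin)
    have "verts G \<subseteq> X \<union> W"
      using True partition_onD1[OF partP] by (auto simp: P_eq)
    then have "n \<le> card (X \<union> W)"
      unfolding assms(3) using fins by (intro card_mono) auto
    also have "\<dots> \<le> card X + (card (V 3) + card V4')"
      using card_Un_le[of X W] card_Un_le[of "V 3" V4'] by (simp add: W_def)
    \<comment> \<open>Cancelling \<open>card (V 3)\<close> and inserting the bound on
      \<open>card V4'\<close> leaves \<open>card (V 4) \<le> card X + 11/24 * card (V 4)\<close>,
      which is where the factor \<open>24/13\<close> comes from.\<close>
    finally show ?thesis using n assms(19) opts(1) by linarith
  next
    case False
    then have "card A \<le> card (V 2) \<or> card B \<le> card (V 2) \<or> card C \<le> card (V 2)"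
      using small by blast
    \<comment> \<open>As \<open>n > 2 * card (V 4)\<close> and one part is below
      \<open>card (V 4) / 6\<close>, the other three exceed \<open>11/6 * card (V 4)\<close> in
      total. So \<open>OPT G > 11/18 * card (V 4)\<close>, and \<open>11/18 > 13/24\<close>.\<close>
    then show ?thesis using sum opts assms(9,11) by linarith
  qed
qed

end
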